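(* Let $n\ge 2$ be an integer and let $X$ be an $n$-Urysohn homogeneous topological space. Then $|X|\le 2^{c(X)\pi\chi(X)}$.
   Context: No separation axioms are assumed unless stated. The Urysohn number $U(X)$ of a topological space $X$ is the least cardinal $\kappa$ (finite or infinite) such that for every $A\subseteq X$ with $|A|\ge\kappa$ there are open neighbourhoods $U_a$ of $a$, for $a\in A$, with $\bigcap_{a\in A}\overline{U_a}=\emptyset$. $X$ is $n$-Urysohn if $U(X)\le n$. $X$ is homogeneous if for all $x,y\in X$ there is a homeomorphism $h:X\to X$ with $h(x)=y$. $c(X)$ is the cellularity (supremum of cardinalities of families of pairwise disjoint nonempty open sets) and $\pi\chi(X)$ is the $\pi$-character (supremum over $x\in X$ of the least cardinality of a local $\pi$-base at $x$, i.e. a family of nonempty open sets such that each neighbourhood of $x$ contains a member of it). All cardinal functions are multiplied by $\omega$, hence are infinite. *)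

theory Defs
  imports "HOL-Analysis.Analysis"
begin

unbundle cardinal_syntax
no_notation elt_set_eq (infix "=o" 50)

text \<open>
  Cardinals are cardinal orders in the sense of the library (\<open>Card_order\<close>), compared
  across types by \<open>\<le>o\<close>, so a cardinal is determined only up to \<open>=o\<close>.
\<close>

definition least_card :: "('b rel \<Rightarrow> bool) \<Rightarrow> 'b rel" where
  "least_card P = (SOME r. Card_order r \<and> P r \<and> (\<forall>s. Card_order s \<and> P s \<longrightarrow> r \<le>o s))"

lemma least_card:
  fixes r :: "'b rel"
  assumes "Card_order r" "P r"
  shows "Card_order (least_card P) \<and> P (least_card P) \<and>
    (\<forall>s. Card_order s \<and> P s \<longrightarrow> least_card P \<le>o s)"
proof -
  let ?R = "{r. Card_order r \<and> P r}"
  have "\<exists>r\<in>?R. \<forall>s\<in>?R. r \<le>o s"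
    using assms by (intro exists_minim_Card_order) auto
  then have "\<exists>r. Card_order r \<and> P r \<and> (\<forall>s. Card_order s \<and> P s \<longrightarrow> r \<le>o s)"
    by auto
  then show ?thesis
    unfolding least_card_def by (rule someI_ex)
qed

definition urysohn_at :: "'a topology \<Rightarrow> 'k rel \<Rightarrow> bool" where
  "urysohn_at X \<kappa> \<longleftrightarrow>
    (\<forall>A. A \<subseteq> topspace X \<and> \<kappa> \<le>o |A| \<longrightarrow>
      (\<exists>U. (\<forall>a\<in>A. openin X (U a) \<and> a \<in> U a) \<and>
           topspace X \<inter> (\<Inter>a\<in>A. X closure_of (U a)) = {}))"

text \<open>
  The Urysohn number may be the successor of the cardinality of the space, so it need not be
  realised on the type \<^typ>\<open>'a\<close>; by Cantor's theorem it always is on \<^typ>\<open>'a set\<close>.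
\<close>

definition urysohn_number :: "'a topology \<Rightarrow> 'a set rel" where
  "urysohn_number X = least_card (urysohn_at X)"

lemma urysohn_at_UNIV: "urysohn_at (X :: 'a topology) |UNIV :: 'a set set|"
proof -
  have False if "|UNIV :: 'a set set| \<le>o |A|" for A :: "'a set"
  proof -
    have "|UNIV :: 'a set set| \<le>o |UNIV :: 'a set|"
      by (rule ordLeq_transitive[OF that card_of_mono1[OF subset_UNIV]])
    then show False
      using not_ordLess_ordLeq[OF card_of_Pow[of "UNIV :: 'a set"]] by simp
  qed
  then show ?thesis
    unfolding urysohn_at_def by blast
qed

definition n_Urysohn :: "nat \<Rightarrow> 'a topology \<Rightarrow> bool" where
  "n_Urysohn n X \<longleftrightarrow> urysohn_number X \<le>o |{..<n}|"

definition homogeneous_space :: "'a topology \<Rightarrow> bool" where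
  "homogeneous_space X \<longleftrightarrow>
    (\<forall>x\<in>topspace X. \<forall>y\<in>topspace X. \<exists>h. homeomorphic_map X X h \<and> h x = y)"

text \<open>
  The supremum of the cardinalities of families of subsets of \<^typ>\<open>'a\<close>, and the least cardinality
  of such a family, are always realised on \<^typ>\<open>'a set\<close>. The factor \<^const>\<open>natLeq\<close>, that is
  \<open>\<omega>\<close>, makes the invariants of a nonempty space infinite.
\<close>

definition cellular_family :: "'a topology \<Rightarrow> 'a set set \<Rightarrow> bool" where
  "cellular_family X F \<longleftrightarrow> (\<forall>U\<in>F. openin X U \<and> U \<noteq> {}) \<and> pairwise disjnt F"

definition cellularity :: "'a topology \<Rightarrow> ('a set \<times> nat) rel" where
  "cellularity X =
    least_card (\<lambda>\<kappa> :: 'a set rel. \<forall>F. cellular_family X F \<longrightarrow> |F| \<le>o \<kappa>) *c natLeq"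

lemma cellularity_bound_UNIV: "\<forall>F. cellular_family X F \<longrightarrow> |F| \<le>o |UNIV :: 'a set set|"
  for X :: "'a topology"
  by (simp add: card_of_mono1)

definition local_pi_base :: "'a topology \<Rightarrow> 'a \<Rightarrow> 'a set set \<Rightarrow> bool" where
  "local_pi_base X x \<B> \<longleftrightarrow>
    (\<forall>B\<in>\<B>. openin X B \<and> B \<noteq> {}) \<and>
    (\<forall>V. openin X V \<and> x \<in> V \<longrightarrow> (\<exists>B\<in>\<B>. B \<subseteq> V))"

definition pi_character_at :: "'a topology \<Rightarrow> 'a \<Rightarrow> 'a set rel" where
  "pi_character_at X x = least_card (\<lambda>\<kappa>. \<exists>\<B>. local_pi_base X x \<B> \<and> |\<B>| =o \<kappa>)"

lemma local_pi_base_exists: "local_pi_base X x {B. openin X B \<and> B \<noteq> {}}"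
  by (auto simp: local_pi_base_def)

lemma Card_order_pi_character_at: "Card_order (pi_character_at X x)"
proof -
  let ?P = "\<lambda>\<kappa>. \<exists>\<B>. local_pi_base X x \<B> \<and> |\<B>| =o \<kappa>"
  have "?P |{B. openin X B \<and> B \<noteq> {}}|"
    by (rule exI, rule conjI[OF local_pi_base_exists card_of_refl])
  from least_card[of _ ?P, OF card_of_Card_order this] show ?thesis
    unfolding pi_character_at_def by (rule conjunct1)
qed

definition pi_character :: "'a topology \<Rightarrow> ('a set \<times> nat) rel" where
  "pi_character X =
    least_card (\<lambda>\<kappa> :: 'a set rel. \<forall>x\<in>topspace X. pi_character_at X x \<le>o \<kappa>) *c natLeq"

lemma pi_character_bound_UNIV: "\<forall>x\<in>topspace X. pi_character_at X x \<le>o |UNIV :: 'a set set|"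
  for X :: "'a topology"
proof -
  have "pi_character_at X x \<le>o |UNIV :: 'a set set|" for x
  proof -
    have "|Field (pi_character_at X x)| \<le>o |UNIV :: 'a set set|"
      by (simp add: card_of_mono1)
    then show ?thesis
      by (rule ordIso_ordLeq_trans[OF ordIso_symmetric[OF card_of_Field_ordIso[OF
        Card_order_pi_character_at]]])
  qed
  then show ?thesis by blast
qed

end

theory Submission
  imports Defs
begin

text \<open>
  Let \<open>\<kappa> = c(X)\<pi>\<chi>(X)\<close>. A family of \<open>2\<^sup>\<kappa>\<close> open sets that is closed under passing from
  at most \<open>\<kappa>\<close> members to a local \<open>\<pi>\<close>-base at a point outside the closure of their union yields a set
  \<open>D\<close> of at most \<open>2\<^sup>\<kappa>\<close> points meeting the closure of every nonempty open set: a maximal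
  cellular subfamily avoiding a counterexample would produce a new point of \<open>D\<close> outside its closure.
  Fix a point \<open>p\<close>, a local \<open>\<pi>\<close>-base \<open>\<B>\<close> at \<open>p\<close> and homeomorphisms \<open>h x\<close> taking \<open>p\<close> to \<open>x\<close>.
  Choosing a point of \<open>D\<close> in the closure of each \<open>h x ` B\<close> maps \<open>X\<close> to the functions from \<open>\<B>\<close>
  to \<open>D\<close>, and the Urysohn condition bounds the fibres: for \<open>n\<close> points in one fibre, pulling their
  separating neighbourhoods back to \<open>p\<close> and taking \<open>B\<close> inside the intersection puts the common
  value at \<open>B\<close> into all \<open>n\<close> closures.
\<close>

section \<open>Counting bounded subsets and closing off\<close>

text \<open>A nonempty such subset is the range of a function from \<open>Field \<kappa>\<close> to
  \<open>E\<close>, and (2^\<kappa>)^\<kappa> = 2^\<kappa>. The empty set is added separately, being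
  no such range.\<close>

lemma card_of_bounded_subsets_ordLeq:
  assumes \<kappa>: "Cinfinite \<kappa>" and E: "|E| \<le>o ctwo ^c \<kappa>"
  shows "|{V. V \<subseteq> E \<and> |V| \<le>o \<kappa>}| \<le>o ctwo ^c \<kappa>"
proof -
  let ?F = "Func (Field \<kappa>) E"
  have co: "Card_order \<kappa>" using \<kappa> by simp
  have inf: "Cinfinite (ctwo ^c \<kappa>)"
    using \<kappa> by (intro Cinfinite_cexp ordLeq_refl Card_order_ctwo)
  have "|?F| = |E| ^c \<kappa>"
    by (simp add: cexp_def Field_card_of)
  also have "|E| ^c \<kappa> \<le>o (ctwo ^c \<kappa>) ^c \<kappa>"
    by (rule cexp_mono1[OF E co])
  also have "(ctwo ^c \<kappa>) ^c \<kappa> =o ctwo ^c \<kappa>"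
    using \<kappa> by (intro cexp_cprod_ordLeq Card_order_ctwo Cinfinite_Cnotzero ordLeq_refl) auto
  finally have F: "|?F| \<le>o ctwo ^c \<kappa>" .
  have "V \<in> insert {} ((\<lambda>g. g ` Field \<kappa>) ` ?F)" if V: "V \<subseteq> E" "|V| \<le>o \<kappa>" for V
  proof (cases "V = {}")
    case False
    have "|V| \<le>o |Field \<kappa>|"
      by (rule ordLeq_ordIso_trans[OF V(2) ordIso_symmetric[OF card_of_Field_ordIso[OF co]]])
    then obtain g where g: "g ` Field \<kappa> = V"
      unfolding card_of_ordLeq2[OF False, symmetric] by (rule exE)
    let ?g = "\<lambda>x. if x \<in> Field \<kappa> then g x else undefined"
    have "?g \<in> ?F" "?g ` Field \<kappa> = V"
      using g V by (auto simp: Func_def)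
    then show ?thesis by blast
  qed simp
  then have "{V. V \<subseteq> E \<and> |V| \<le>o \<kappa>} \<subseteq> {{}} \<union> (\<lambda>g. g ` Field \<kappa>) ` ?F"
    by auto
  moreover have "|{{}} \<union> (\<lambda>g. g ` Field \<kappa>) ` ?F| \<le>o ctwo ^c \<kappa>"
  proof (rule card_of_Un_ordLeq_infinite_Field)
    show "|{{}}| \<le>o ctwo ^c \<kappa>"
      using inf by (intro Card_order_singl_ordLeq) (auto simp: cinfinite_def)
    show "|(\<lambda>g. g ` Field \<kappa>) ` ?F| \<le>o ctwo ^c \<kappa>"
      by (rule ordLeq_transitive[OF card_of_image F])
  qed (use inf in \<open>auto simp: cinfinite_def\<close>)
  ultimately show ?thesis
    by (meson card_of_mono1 ordLeq_transitive)
qed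

text \<open>Transfinite recursion along \<open>r\<close> in the guise of an inductive predicate,
  which is definable without a well-order. The choice \<open>V = {}\<close> starts it.\<close>

inductive closure_stage :: "'i rel \<Rightarrow> 'k rel \<Rightarrow> ('b set \<Rightarrow> 'b set) \<Rightarrow> 'i \<Rightarrow> 'b \<Rightarrow> bool"
  for r \<kappa> f where
  "\<lbrakk>\<forall>v\<in>V. \<exists>\<beta>\<in>underS r \<alpha>. closure_stage r \<kappa> f \<beta> v; |V| \<le>o \<kappa>; b \<in> f V\<rbrakk>
    \<Longrightarrow> closure_stage r \<kappa> f \<alpha> b"

text \<open>
  The stages are indexed by \<open>\<kappa>\<^sup>+\<close>, whose regularity makes every subset of the union of size
  at most \<open>\<kappa>\<close> appear at some stage.
\<close>

lemma closed_under_bounded_subsets_exists: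
  fixes f :: "'b set \<Rightarrow> 'b set" and \<kappa> :: "'k rel"
  assumes \<kappa>: "Cinfinite \<kappa>"
    and f: "\<And>V. |f V| \<le>o ctwo ^c \<kappa>"
  obtains E where "|E| \<le>o ctwo ^c \<kappa>" "\<And>V. V \<subseteq> E \<Longrightarrow> |V| \<le>o \<kappa> \<Longrightarrow> f V \<subseteq> E"
proof -
  let ?r = "cardSuc \<kappa>"
  let ?P = "ctwo ^c \<kappa>"
  define S where "S \<alpha> = {b. closure_stage ?r \<kappa> f \<alpha> b}" for \<alpha>
  define A where "A \<alpha> = (\<Union>\<beta>\<in>underS ?r \<alpha>. S \<beta>)" for \<alpha>
  have co: "Card_order \<kappa>" using \<kappa> by simp
  have P: "Cinfinite ?P"
    using \<kappa> by (intro Cinfinite_cexp ordLeq_refl Card_order_ctwo)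
  have r: "Cinfinite ?r"
    by (rule Cinfinite_cardSuc[OF \<kappa>])
  have rP: "?r \<le>o ?P"
    by (intro cardSuc_least co Card_order_cexp ordLess_ctwo_cexp)
  have wo: "Well_order ?r"
    using r unfolding card_order_on_def by blast
  have S: "S \<alpha> = (\<Union>V\<in>{V. V \<subseteq> A \<alpha> \<and> |V| \<le>o \<kappa>}. f V)" for \<alpha>
  proof (rule set_eqI)
    fix b
    have "b \<in> S \<alpha> \<longleftrightarrow> (\<exists>V. (\<forall>v\<in>V. \<exists>\<beta>\<in>underS ?r \<alpha>. v \<in> S \<beta>) \<and> |V| \<le>o \<kappa> \<and> b \<in> f V)"
      unfolding S_def mem_Collect_eq by (subst closure_stage.simps) blast
    then show "b \<in> S \<alpha> \<longleftrightarrow> b \<in> (\<Union>V\<in>{V. V \<subseteq> A \<alpha> \<and> |V| \<le>o \<kappa>}. f V)"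
      by (auto simp: A_def subset_eq)
  qed
  have A_le: "|A \<alpha>| \<le>o ?P" if "\<And>\<beta>. \<beta> \<in> underS ?r \<alpha> \<Longrightarrow> |S \<beta>| \<le>o ?P" for \<alpha>
    unfolding A_def
  proof (rule UNION_Cinfinite_bound[OF _ _ P])
    have "|underS ?r \<alpha>| \<le>o |Field ?r|"
      by (intro card_of_mono1) (auto simp: underS_def Field_def)
    also have "|Field ?r| \<le>o ?P"
      using card_of_Field_ordIso[of ?r] r rP ordIso_ordLeq_trans by blast
    finally show "|underS ?r \<alpha>| \<le>o ?P" .
  qed (use that in blast)
  \<comment> \<open>Induction over the stages: the earlier stages have at most 2^\<kappa> bounded
    subsets, and each contributes at most 2^\<kappa> elements.\<close>
  have "wf (?r - Id)"
    using wo by (simp add: well_order_on_def)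
  then have S_le: "|S \<alpha>| \<le>o ?P" for \<alpha>
  proof (induction \<alpha> rule: wf_induct_rule)
    case (less \<alpha>)
    then have "|{V. V \<subseteq> A \<alpha> \<and> |V| \<le>o \<kappa>}| \<le>o ?P"
      by (intro card_of_bounded_subsets_ordLeq[OF \<kappa>] A_le) (auto simp: underS_def)
    then show "|S \<alpha>| \<le>o ?P"
      unfolding S using f by (intro UNION_Cinfinite_bound P) auto
  qed
  define E where "E = (\<Union>\<alpha>\<in>Field ?r. S \<alpha>)"
  show ?thesis
  proof
    show "|E| \<le>o ?P"
      unfolding E_def
    proof (rule UNION_Cinfinite_bound[OF _ _ P])
      show "|Field ?r| \<le>o ?P"
        using r by (intro ordIso_ordLeq_trans[OF card_of_Field_ordIso rP]) simp
    qed (use S_le in blast)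
  next
    fix V assume V: "V \<subseteq> E" "|V| \<le>o \<kappa>"
    have "trans ?r" "antisym ?r"
      using wo unfolding order_on_defs by blast+
    then have chain: "relChain ?r A"
      unfolding relChain_def A_def using underS_incr by fast
    \<comment> \<open>An infinite cardinal has no largest index, so each stage is contained in a
      later \<open>A\<close>.\<close>
    have "E \<subseteq> (\<Union>\<alpha>\<in>Field ?r. A \<alpha>)"
    proof
      fix b assume "b \<in> E"
      then obtain \<alpha> where \<alpha>: "\<alpha> \<in> Field ?r" "b \<in> S \<alpha>"
        unfolding E_def by blast
      obtain \<beta> where "\<beta> \<in> Field ?r" "\<alpha> \<noteq> \<beta>" "(\<alpha>, \<beta>) \<in> ?r"
        using infinite_Card_order_limit[of ?r \<alpha>] r \<alpha>(1) by (auto simp: cinfinite_def)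
      then show "b \<in> (\<Union>\<alpha>\<in>Field ?r. A \<alpha>)"
        using \<alpha>(2) by (auto simp: A_def underS_def)
    qed
    then obtain \<alpha> where "\<alpha> \<in> Field ?r" "V \<subseteq> A \<alpha>"
      using cardSuc_UNION_Cinfinite[OF \<kappa> chain _ V(2)] V(1) by blast
    then show "f V \<subseteq> E"
      using S[of \<alpha>] V(2) by (auto simp: E_def)
  qed
qed

section \<open>Small theta-dense sets\<close>

text \<open>Equivalently, the theta-closure of \<open>D\<close> is the whole space.\<close>

definition theta_dense :: "'a topology \<Rightarrow> 'a set \<Rightarrow> bool" where
  "theta_dense X D \<longleftrightarrow> (\<forall>U. openin X U \<and> U \<noteq> {} \<longrightarrow> X closure_of U \<inter> D \<noteq> {})"

text \<open>Cellularity bounds the maximal family \<open>M\<close>, so \<open>p M\<close> is in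
  \<open>D\<close>; the pi-bases contained in \<open>E\<close> let maximality force all of
  \<open>D\<close> into the closure of \<open>\<Union>M\<close>, which \<open>p M\<close>
  avoids.\<close>

lemma theta_dense_exists:
  fixes X :: "'a topology" and \<kappa> :: "'k rel"
  assumes \<kappa>: "Cinfinite \<kappa>"
    and cell: "\<And>F. cellular_family X F \<Longrightarrow> |F| \<le>o \<kappa>"
    and base: "\<And>x. x \<in> topspace X \<Longrightarrow> local_pi_base X x (\<B> x) \<and> |\<B> x| \<le>o \<kappa>"
  obtains D where "theta_dense X D" "|D| \<le>o ctwo ^c \<kappa>"
proof (cases "topspace X = {}")
  case True
  have "theta_dense X {}"
    using True openin_subset unfolding theta_dense_def by fastforce
  then show ?thesis
    using that[of "{}"] by (simp add: Card_order_cexp Card_order_empty)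
next
  case False
  then obtain x0 where x0: "x0 \<in> topspace X" by blast
  \<comment> \<open>The default \<open>x0\<close> keeps \<open>p V\<close> in the space even if
    \<open>\<Union>V\<close> is dense, so the size of \<open>\<B> (p V)\<close> is bounded for every
    \<open>V\<close>.\<close>
  define p where "p V = (if topspace X \<subseteq> X closure_of (\<Union>V) then x0
     else (SOME x. x \<in> topspace X - X closure_of (\<Union>V)))" for V
  have p_notin: "p V \<in> topspace X - X closure_of (\<Union>V)"
    if "\<not> topspace X \<subseteq> X closure_of (\<Union>V)" for V
    using that some_in_eq[of "topspace X - X closure_of (\<Union>V)"] unfolding p_def by auto
  have p_in: "p V \<in> topspace X" for V
    using p_notin[of V] x0 by (cases "topspace X \<subseteq> X closure_of (\<Union>V)") (auto simp: p_def)
  have "|\<B> (p V)| \<le>o ctwo ^c \<kappa>" for V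
    using base[OF p_in] ordLess_ctwo_cexp[of \<kappa>] \<kappa> ordLeq_transitive ordLess_imp_ordLeq by blast
  then obtain E where E: "|E| \<le>o ctwo ^c \<kappa>"
    and cl: "\<And>V. V \<subseteq> E \<Longrightarrow> |V| \<le>o \<kappa> \<Longrightarrow> \<B> (p V) \<subseteq> E"
    using closed_under_bounded_subsets_exists[OF \<kappa>, of "\<lambda>V. \<B> (p V)"] by metis
  define D where "D = p ` {V. V \<subseteq> E \<and> |V| \<le>o \<kappa>}"
  have "theta_dense X D"
    unfolding theta_dense_def
  proof (intro allI impI notI, elim conjE)
    fix U assume U: "openin X U" "U \<noteq> {}" and disj: "X closure_of U \<inter> D = {}"
    let ?W = "topspace X - X closure_of U"
    let ?C = "{F. cellular_family X F \<and> F \<subseteq> E \<inter> Pow ?W}"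
    \<comment> \<open>Members are confined to \<open>?W\<close> so that \<open>U\<close> stays
      disjoint from the closure of their union.\<close>
    have "\<exists>M\<in>?C. \<forall>F\<in>?C. M \<subseteq> F \<longrightarrow> F = M"
    proof (rule subset_Zorn_nonempty)
      have "{} \<in> ?C" by (simp add: cellular_family_def)
      then show "?C \<noteq> {}" by blast
      fix \<C> assume "\<C> \<noteq> {}" and ch: "subset.chain ?C \<C>"
      have "chain\<^sub>\<subseteq> \<C>"
        using ch by (simp add: subset_chain_def chain_subset_def)
      then have "pairwise disjnt (\<Union>\<C>)"
        using ch by (intro pairwise_chain_Union) (auto simp: subset.chain_def cellular_family_def)
      then show "\<Union>\<C> \<in> ?C"
        using ch by (fastforce simp: subset.chain_def cellular_family_def)
    qed
    then obtain M where "M \<in> ?C" and M_max: "\<forall>F\<in>?C. M \<subseteq> F \<longrightarrow> F = M"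
      by (rule bexE)
    then have M: "cellular_family X M" "M \<subseteq> E" "M \<subseteq> Pow ?W"
      by simp_all
    have max: "F = M" if "cellular_family X F" "F \<subseteq> E" "F \<subseteq> Pow ?W" "M \<subseteq> F" for F
      using M_max that by simp
    have MD: "p M \<in> D"
      using M(2) cell[OF M(1)] unfolding D_def by simp
    \<comment> \<open>As \<open>d\<close> lies in \<open>?W\<close>, a member of
      \<open>\<B> d\<close> fits into \<open>T \<inter> ?W\<close>; if \<open>T\<close> missed
      \<open>\<Union>M\<close>, it could be added to \<open>M\<close>.\<close>
    have D_cl: "d \<in> X closure_of (\<Union>M)" if d: "d \<in> D" for d
    proof -
      obtain V where V: "V \<subseteq> E" "|V| \<le>o \<kappa>" "d = p V"
        using d unfolding D_def by blast
      have dX: "d \<in> topspace X" using V p_in by simp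
      have BE: "\<B> d \<subseteq> E" using cl V by simp
      have "\<exists>y\<in>\<Union>M. y \<in> T" if T: "openin X T" "d \<in> T" for T
      proof -
        have "openin X ?W"
          by (simp add: closedin_closure_of openin_diff)
        then have "openin X (T \<inter> ?W)" "d \<in> T \<inter> ?W"
          using T d dX disj by (auto intro: openin_Int)
        then obtain B where B: "B \<in> \<B> d" "B \<subseteq> T \<inter> ?W" "openin X B" "B \<noteq> {}"
          using base[OF dX] unfolding local_pi_base_def by meson
        show ?thesis
        proof (rule ccontr)
          assume no: "\<not> ?thesis"
          have "cellular_family X (insert B M)"
            using M(1) B no unfolding cellular_family_def
            by (auto simp: pairwise_insert disjnt_def)
          then have "insert B M = M"
            using M B BE by (intro max) auto
          then have "B \<in> M" by blast
          then show False using no B(2,4) by blast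
        qed
      qed
      then show ?thesis
        using dX unfolding in_closure_of by blast
    qed
    \<comment> \<open>The nonempty open set \<open>U\<close> shows that \<open>\<Union>M\<close> is
      not dense, so \<open>p M\<close> is no default value.\<close>
    have "U \<inter> \<Union>M = {}"
      using M(3) closure_of_subset[OF openin_subset[OF U(1)]] by blast
    then have "U \<inter> X closure_of (\<Union>M) = {}"
      using openin_Int_closure_of_eq_empty[OF U(1)] by simp
    then have "\<not> topspace X \<subseteq> X closure_of (\<Union>M)"
      using U openin_subset by blast
    then show False
      using p_notin D_cl[OF MD] by blast
  qed
  moreover have "|D| \<le>o ctwo ^c \<kappa>"
    unfolding D_def
    by (rule ordLeq_transitive[OF card_of_image card_of_bounded_subsets_ordLeq[OF \<kappa> E]])
  ultimately show ?thesis by (rule that)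
qed

section \<open>The Urysohn condition and homogeneity\<close>

text \<open>The least cardinal is attained, so \<open>urysohn_at\<close> holds at the Urysohn number
  itself, which is at most \<open>n\<close> and hence at most the size of \<open>A\<close>.\<close>

lemma n_Urysohn_separation:
  fixes X :: "'a topology"
  assumes "n_Urysohn n X" "A \<subseteq> topspace X" "finite A" "n \<le> card A"
  obtains U where "\<And>a. a \<in> A \<Longrightarrow> openin X (U a) \<and> a \<in> U a"
    "topspace X \<inter> (\<Inter>a\<in>A. X closure_of (U a)) = {}"
proof -
  have "urysohn_at X (urysohn_number X)"
    using least_card[of _ "urysohn_at X", OF card_of_Card_order urysohn_at_UNIV]
    unfolding urysohn_number_def by blast
  moreover have "|{..<n}| \<le>o |A|"
    using assms inj_on_iff_card_le[of "{..<n}" A] card_of_ordLeq[of "{..<n}" A] by simp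
  then have "urysohn_number X \<le>o |A|"
    using assms(1) unfolding n_Urysohn_def by (meson ordLeq_transitive)
  ultimately show ?thesis
    using assms(2) that unfolding urysohn_at_def by metis
qed

text \<open>A map \<open>\<phi>\<close> with finite fibres and at most (2^\<kappa>)^\<kappa> =
  2^\<kappa> values. Homogeneity lets one pi-base at \<open>p\<close> serve all points.\<close>

lemma homogeneous_card_bound:
  fixes X :: "'a topology" and \<kappa> :: "'k rel"
  assumes \<kappa>: "Cinfinite \<kappa>" and n: "n \<ge> 1"
    and ury: "n_Urysohn n X" and hom: "homogeneous_space X"
    and D: "theta_dense X D" "|D| \<le>o ctwo ^c \<kappa>"
    and p: "p \<in> topspace X" and base: "local_pi_base X p \<B>" "|\<B>| \<le>o \<kappa>"
  shows "|topspace X| \<le>o ctwo ^c \<kappa>"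
proof -
  let ?P = "ctwo ^c \<kappa>"
  have P: "Cinfinite ?P"
    using \<kappa> by (intro Cinfinite_cexp ordLeq_refl Card_order_ctwo)
  obtain h where h: "\<And>x. x \<in> topspace X \<Longrightarrow> homeomorphic_map X X (h x) \<and> h x p = x"
    using hom p unfolding homogeneous_space_def by metis
  have "\<exists>d. d \<in> X closure_of (h x ` B) \<inter> D" if "x \<in> topspace X" "B \<in> \<B>" for x B
  proof -
    have "openin X (h x ` B)" "h x ` B \<noteq> {}"
      using h[OF that(1)] base(1) that(2) homeomorphic_imp_open_map[of X X "h x"]
      unfolding local_pi_base_def open_map_def by auto
    then show ?thesis
      using D(1) unfolding theta_dense_def by blast
  qed
  then obtain d where d: "\<And>x B. x \<in> topspace X \<Longrightarrow> B \<in> \<B> \<Longrightarrow>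
      d x B \<in> X closure_of (h x ` B) \<inter> D"
    by metis
  define \<phi> where "\<phi> x = (\<lambda>B. if B \<in> \<B> then d x B else undefined)" for x
  have \<phi>_Func: "\<phi> ` topspace X \<subseteq> Func \<B> D"
    using d by (auto simp: \<phi>_def Func_def)
  have fibre: "finite {x \<in> topspace X. \<phi> x = g}" for g
  proof (rule ccontr)
    assume "infinite {x \<in> topspace X. \<phi> x = g}"
    then obtain A where A: "A \<subseteq> {x \<in> topspace X. \<phi> x = g}" "finite A" "card A = n"
      using infinite_arbitrarily_large by blast
    then have AX: "A \<subseteq> topspace X" by blast
    obtain U where U: "\<And>a. a \<in> A \<Longrightarrow> openin X (U a) \<and> a \<in> U a"
      and sep: "topspace X \<inter> (\<Inter>a\<in>A. X closure_of (U a)) = {}"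
      using n_Urysohn_separation[OF ury AX] A by auto
    \<comment> \<open>Here \<open>n \<ge> 1\<close> matters: an empty intersection would be the
      whole type instead of an open set.\<close>
    have A0: "A \<noteq> {}" using A n by auto
    let ?N = "\<Inter>a\<in>A. {y \<in> topspace X. h a y \<in> U a}"
    have "openin X ?N"
    proof (rule openin_Inter)
      fix T assume "T \<in> (\<lambda>a. {y \<in> topspace X. h a y \<in> U a}) ` A"
      then obtain a where a: "a \<in> A" "T = {y \<in> topspace X. h a y \<in> U a}" by blast
      then show "openin X T"
        using U AX h homeomorphic_imp_continuous_map[of X X "h a"]
        by (auto intro: openin_continuous_map_preimage)
    qed (use A A0 in auto)
    moreover have "p \<in> ?N"
      using p h U AX by auto
    ultimately obtain B where B: "B \<in> \<B>" "B \<subseteq> ?N"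
      using base(1) unfolding local_pi_base_def by meson
    \<comment> \<open>All points of \<open>A\<close> share the value \<open>g B\<close>, and each
      \<open>h a\<close> maps \<open>B\<close> into \<open>U a\<close>, so this one point lies in
      every closure.\<close>
    have "g B \<in> X closure_of (U a)" if a: "a \<in> A" for a
    proof -
      have "g B = d a B"
        using a A(1) B(1) by (auto simp: \<phi>_def)
      also have "d a B \<in> X closure_of (h a ` B)"
        using d a AX B(1) by blast
      also have "\<dots> \<subseteq> X closure_of (U a)"
        using B(2) a by (intro closure_of_mono) auto
      finally show ?thesis .
    qed
    then have "g B \<in> topspace X \<inter> (\<Inter>a\<in>A. X closure_of (U a))"
      using A0 closure_of_subset_topspace by fastforce
    then show False using sep by blast
  qed
  have "|\<phi> ` topspace X| \<le>o |Func \<B> D|"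
    by (rule card_of_mono1[OF \<phi>_Func])
  also have "|Func \<B> D| = |D| ^c |\<B>|"
    by (simp add: cexp_def Field_card_of)
  also have "|D| ^c |\<B>| \<le>o ?P ^c \<kappa>"
  proof (rule cexp_mono'[OF D(2) base(2)])
    \<comment> \<open>Monotonicity in the exponent fails at 0^0 = 1, so the smaller exponent must be
      nonzero.\<close>
    have "\<B> \<noteq> {}"
      using base(1) p unfolding local_pi_base_def by blast
    then show "Field |\<B>| = {} \<Longrightarrow> Field \<kappa> = {}" by (simp add: Field_card_of)
  qed
  also have "?P ^c \<kappa> =o ?P"
    using \<kappa> by (intro cexp_cprod_ordLeq Card_order_ctwo Cinfinite_Cnotzero ordLeq_refl) auto
  finally have img: "|\<phi> ` topspace X| \<le>o ?P" .
  have "|\<Union>g\<in>\<phi> ` topspace X. {x \<in> topspace X. \<phi> x = g}| \<le>o ?P"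
  proof (rule UNION_Cinfinite_bound[OF img _ P], intro ballI ordLess_imp_ordLeq)
    fix g
    show "|{x \<in> topspace X. \<phi> x = g}| <o ?P"
      using P fibre[of g]
      by (intro finite_ordLess_infinite)
        (auto simp: Field_card_of cinfinite_def card_of_well_order_on card_order_on_well_order_on)
  qed
  moreover have "(\<Union>g\<in>\<phi> ` topspace X. {x \<in> topspace X. \<phi> x = g}) = topspace X"
    by auto
  ultimately show ?thesis by simp
qed

section \<open>The invariants as attained, infinite bounds\<close>

text \<open>A least upper bound among cardinals is itself an upper bound, and the factor
  \<open>natLeq\<close> only enlarges it.\<close>

lemma cellular_family_ordLeq_cellularity:
  fixes X :: "'a topology"
  assumes "cellular_family X F"
  shows "|F| \<le>o cellularity X"
proof -
  let ?P = "\<lambda>\<kappa> :: 'a set rel. \<forall>F. cellular_family X F \<longrightarrow> |F| \<le>o \<kappa>"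
  have l: "Card_order (least_card ?P) \<and> ?P (least_card ?P)"
    using least_card[of _ ?P, OF card_of_Card_order cellularity_bound_UNIV] by blast
  then have "|F| \<le>o least_card ?P" using assms by blast
  also have "least_card ?P \<le>o least_card ?P *c natLeq"
    using l natLeq_Cinfinite unfolding cprod_def
    by (intro Card_order_Times1) (auto simp: cinfinite_def)
  finally show ?thesis unfolding cellularity_def .
qed

lemma pi_character_at_ordLeq_pi_character:
  fixes X :: "'a topology"
  assumes "x \<in> topspace X"
  shows "pi_character_at X x \<le>o pi_character X"
proof -
  let ?P = "\<lambda>\<kappa> :: 'a set rel. \<forall>x\<in>topspace X. pi_character_at X x \<le>o \<kappa>"
  have l: "Card_order (least_card ?P) \<and> ?P (least_card ?P)"
    using least_card[of _ ?P, OF card_of_Card_order pi_character_bound_UNIV] by blast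
  then have "pi_character_at X x \<le>o least_card ?P" using assms by blast
  also have "least_card ?P \<le>o least_card ?P *c natLeq"
    using l natLeq_Cinfinite unfolding cprod_def
    by (intro Card_order_Times1) (auto simp: cinfinite_def)
  finally show ?thesis unfolding pi_character_def .
qed

text \<open>The least size of a local pi-base is attained at each point.\<close>

lemma local_pi_base_ordLeq_pi_character:
  fixes X :: "'a topology"
  assumes "x \<in> topspace X"
  obtains \<B> where "local_pi_base X x \<B>" "|\<B>| \<le>o pi_character X"
proof -
  let ?P = "\<lambda>\<kappa>. \<exists>\<B>. local_pi_base X x \<B> \<and> |\<B>| =o \<kappa>"
  have "?P |{B. openin X B \<and> B \<noteq> {}}|"
    by (rule exI, rule conjI[OF local_pi_base_exists card_of_refl])
  from least_card[of _ ?P, OF card_of_Card_order this]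
  obtain \<B> where "local_pi_base X x \<B>" "|\<B>| =o pi_character_at X x"
    unfolding pi_character_at_def by blast
  then show ?thesis
    using that pi_character_at_ordLeq_pi_character[OF assms] ordIso_ordLeq_trans by blast
qed

lemma Cnotzero_mono_nonempty:
  assumes "|A| \<le>o r" "A \<noteq> {}" "Card_order r"
  shows "Cnotzero r"
  using assms card_of_Card_order[of A]
  by (intro Cnotzero_mono[of "|A|" r]) (auto simp: card_of_ordIso_czero_iff_empty)

text \<open>A zero factor \<open>r\<close> would annihilate \<open>natLeq\<close>; once it is
  excluded, \<open>natLeq\<close> makes the product infinite.\<close>

lemma Cinfinite_cprod_natLeq:
  assumes "Cnotzero (r *c natLeq)"
  shows "Cinfinite (r *c natLeq)"
proof -
  have "Field r \<noteq> {}"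
    using assms by (auto simp: cprod_def card_of_ordIso_czero_iff_empty)
  then show ?thesis
    using natLeq_Cinfinite Card_order_cprod[of r natLeq]
    by (auto simp: cprod_def cinfinite_def Field_card_of finite_cartesian_product_iff)
qed

theorem theorem3p12:
  fixes X :: "'a topology" and n :: nat
  assumes "n \<ge> 2"
    and "n_Urysohn n X"
    and "homogeneous_space X"
  shows "|topspace X| \<le>o ctwo ^c (cellularity X *c pi_character X)"
proof (cases "topspace X = {}")
  \<comment> \<open>On the empty space both invariants are zero despite the factor
    \<open>natLeq\<close>, so this case is settled separately.\<close>
  case True
  then show ?thesis by (simp add: Card_order_cexp Card_order_empty)
next
  case False
  then obtain p where p: "p \<in> topspace X" by blast
  let ?\<kappa> = "cellularity X *c pi_character X"
  obtain \<B> where \<B>: "\<And>x. x \<in> topspace X \<Longrightarrow>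
      local_pi_base X x (\<B> x) \<and> |\<B> x| \<le>o pi_character X"
    using local_pi_base_ordLeq_pi_character by metis
  \<comment> \<open>This one-element family witnesses that the cellularity is nonzero, hence
    infinite.\<close>
  have "cellular_family X {topspace X}"
    using False by (simp add: cellular_family_def)
  then have "|{topspace X}| \<le>o cellularity X"
    by (rule cellular_family_ordLeq_cellularity)
  then have c: "Cinfinite (cellularity X)"
    unfolding cellularity_def
    by (intro Cinfinite_cprod_natLeq Cnotzero_mono_nonempty Card_order_cprod) auto
  \<comment> \<open>The whole space is a neighbourhood of \<open>p\<close>, so it contains a member
    of the pi-base; hence the pi-character is nonzero.\<close>
  have "\<B> p \<noteq> {}"
    using \<B>[OF p] p unfolding local_pi_base_def by blast
  then have pc: "Cinfinite (pi_character X)"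
    using \<B>[OF p] unfolding pi_character_def
    by (intro Cinfinite_cprod_natLeq Cnotzero_mono_nonempty Card_order_cprod) auto
  have \<kappa>: "Cinfinite ?\<kappa>"
    by (intro Cinfinite_cprod2 Cinfinite_Cnotzero c pc)
  have c\<kappa>: "cellularity X \<le>o ?\<kappa>"
    using c pc unfolding cprod_def by (intro Card_order_Times1) (auto simp: cinfinite_def)
  have pc\<kappa>: "pi_character X \<le>o ?\<kappa>"
    using c pc by (intro ordLeq_cprod2 Cinfinite_Cnotzero) auto
  have base: "local_pi_base X x (\<B> x) \<and> |\<B> x| \<le>o ?\<kappa>" if "x \<in> topspace X" for x
    using \<B>[OF that] pc\<kappa> ordLeq_transitive by blast
  have cell: "|F| \<le>o ?\<kappa>" if "cellular_family X F" for F
    using cellular_family_ordLeq_cellularity[OF that] c\<kappa> ordLeq_transitive by blast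
  obtain D where "theta_dense X D" "|D| \<le>o ctwo ^c ?\<kappa>"
    using theta_dense_exists[OF \<kappa> cell base] by blast
  then show ?thesis
    using homogeneous_card_bound[OF \<kappa> _ assms(2,3) _ _ p] base[OF p] assms(1) by auto
qed

end
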